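(* Let $M$ be a matroid of rank $d$ on a finite totally ordered set $\mathsf E$, and let $M_1,\dots,M_k$ be a matroid subdivision of $M$. Let $\chi:\mathsf E^d\to\{+,-,0\}$ be an alternating sign map supported on the set of bases $\mathcal B(M)$ (that is, for a $d$-subset $\sigma$, $\chi(\sigma)\ne 0$ if and only if $\sigma\in\mathcal B(M)$). Suppose that each restriction $\chi_i:\mathcal B(M_i)\to\{+,-\}$ of $\chi$ is a chirotope. Then $\chi$ itself is a chirotope.
   Context: **Matroid subdivision.** The matroid polytope of a matroid $M$ on $\mathsf E$ is the convex hull of the vectors $\mathbf e_B=\sum_{i\in B}\mathbf e_i\in\mathbb R^{\mathsf E}$ over all bases $B\in\mathcal B(M)$. A collection of matroids is a matroid subdivision of $M$ if they all have the same ground set and rank as $M$, and their matroid polytopes (together with their faces) form a polyhedral subdivision of the matroid polytope of $M$. **Chirotope.** A chirotope on $\mathsf E$ of rank $d$ is a non-zero alternating map $\chi:\mathsf E^d\to\{+,-,0\}$ such that for all $x_1,\dots,x_{d-1},y_1,\dots,y_{d+1}\in\mathsf E$ the $d+1$ expressions $(-1)^k\chi(x_1,\dots,x_{d-1},y_k)\,\chi(y_1,\dots,\widehat{y_k},\dots,y_{d+1})$, $k=1,\dots,d+1$, either contain both a positive and a negative term or are all zero. An alternating map is specified by its values $\chi(\sigma)=\chi(\sigma_1,\dots,\sigma_d)$ on $d$-subsets $\sigma=\{\sigma_1<\dots<\sigma_d\}$. The restriction $\chi_i$ is regarded as the alternating map that agrees with $\chi$ on the bases of $M_i$ and is $0$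 on all other $d$-subsets. *)

theory Defs
  imports "HOL-Analysis.Analysis"
begin

section \<open>Matroids, given by their ground set and bases\<close>

definition matroid :: "'a set \<Rightarrow> 'a set set \<Rightarrow> bool" where
  "matroid E \<B> \<longleftrightarrow> finite E \<and> \<B> \<noteq> {} \<and> (\<forall>A\<in>\<B>. A \<subseteq> E) \<and>
     (\<forall>A\<in>\<B>. \<forall>B\<in>\<B>. \<forall>x\<in>A - B. \<exists>y\<in>B - A. insert y (A - {x}) \<in> \<B>)"

text \<open>All bases of a matroid have the same size, so the maximum is just that common size.\<close>

definition matroid_rank :: "'a set set \<Rightarrow> nat" where
  "matroid_rank \<B> = Max (card ` \<B>)"

section \<open>Matroid subdivisions\<close>

text \<open>
  The ground set of a matroid is a subset \<open>E\<close> of a finite type \<open>'e\<close> (so that \<open>E\<close> may be empty);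
  the space of real vectors indexed by \<open>E\<close> is identified with the coordinate subspace
  of \<open>real ^ 'e\<close> of vectors that vanish outside \<open>E\<close>.
\<close>

definition basis_vec :: "'e::finite set \<Rightarrow> real ^ 'e" where
  "basis_vec B = (\<Sum>i\<in>B. axis i 1)"

definition matroid_polytope :: "'e::finite set set \<Rightarrow> (real ^ 'e) set" where
  "matroid_polytope \<B> = convex hull (basis_vec ` \<B>)"

text \<open>As for the library's \<^const>\<open>face_of\<close>, the empty set counts as a face.\<close>

definition polyhedral_subdivision :: "'v::euclidean_space set set \<Rightarrow> 'v set \<Rightarrow> bool" where
  "polyhedral_subdivision \<C> P \<longleftrightarrow> finite \<C> \<and>
     (\<forall>S\<in>\<C>. polytope S) \<and>
     (\<forall>S\<in>\<C>. \<forall>F. F face_of S \<longrightarrow> F \<in> \<C>) \<and>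
     (\<forall>S\<in>\<C>. \<forall>T\<in>\<C>. (S \<inter> T) face_of S \<and> (S \<inter> T) face_of T) \<and>
     \<Union>\<C> = P"

definition matroid_subdivision :: "'e::finite set \<Rightarrow> 'e set set \<Rightarrow> 'e set set set \<Rightarrow> bool" where
  "matroid_subdivision E \<B> \<M> \<longleftrightarrow>
     (\<forall>\<N>\<in>\<M>. matroid E \<N> \<and> matroid_rank \<N> = matroid_rank \<B>) \<and>
     polyhedral_subdivision (\<Union>\<N>\<in>\<M>. {F. F face_of matroid_polytope \<N>}) (matroid_polytope \<B>)"

section \<open>Chirotopes\<close>

text \<open>
  The signs \<open>+, -, 0\<close> are the integers \<open>1, -1, 0\<close>.  A map on \<open>d\<close>-tuples of elements
  of \<open>E\<close> is a function on lists, of which only the values on \<open>tuples E d\<close> matter.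
\<close>

definition tuples :: "'a set \<Rightarrow> nat \<Rightarrow> 'a list set" where
  "tuples E d = {xs. length xs = d \<and> set xs \<subseteq> E}"

definition alternating_sign_map :: "'a set \<Rightarrow> nat \<Rightarrow> ('a list \<Rightarrow> int) \<Rightarrow> bool" where
  "alternating_sign_map E d f \<longleftrightarrow>
     (\<forall>xs\<in>tuples E d. f xs \<in> {1, -1, 0}) \<and>
     (\<forall>xs\<in>tuples E d. \<forall>p. p permutes {..<d} \<longrightarrow> f (permute_list p xs) = sign p * f xs) \<and>
     (\<forall>xs\<in>tuples E d. \<not> distinct xs \<longrightarrow> f xs = 0)"

text \<open>
  The \<open>k\<close>-th exchange expression for \<open>xs = [x\<^sub>1, \<dots>, x\<^sub>d\<^sub>-\<^sub>1]\<close> and \<open>ys = [y\<^sub>1, \<dots>, y\<^sub>d\<^sub>+\<^sub>1]\<close>, where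
  \<open>k\<close> counts from 1: the entry \<open>y\<^sub>k\<close> is \<open>ys ! (k - 1)\<close>, and it is omitted in the second factor.
\<close>

definition exchange_term :: "('a list \<Rightarrow> int) \<Rightarrow> 'a list \<Rightarrow> 'a list \<Rightarrow> nat \<Rightarrow> int" where
  "exchange_term f xs ys k =
     (-1) ^ k * f (xs @ [ys ! (k - 1)]) * f (take (k - 1) ys @ drop k ys)"

text \<open>
  The length condition reads \<open>length xs + 1 = d\<close> rather than \<open>length xs = d - 1\<close> because
  subtraction truncates: in rank 0 there is no exchange condition.
\<close>

definition chirotope :: "'a set \<Rightarrow> nat \<Rightarrow> ('a list \<Rightarrow> int) \<Rightarrow> bool" where
  "chirotope E d f \<longleftrightarrow>
     alternating_sign_map E d f \<and> (\<exists>xs\<in>tuples E d. f xs \<noteq> 0) \<and>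
     (\<forall>xs ys. length xs + 1 = d \<and> set xs \<subseteq> E \<and> ys \<in> tuples E (d + 1) \<longrightarrow>
        (\<exists>k\<in>{1..d + 1}. exchange_term f xs ys k > 0) \<and>
        (\<exists>k\<in>{1..d + 1}. exchange_term f xs ys k < 0) \<or>
        (\<forall>k\<in>{1..d + 1}. exchange_term f xs ys k = 0))"

definition supported_on :: "'a::linorder set \<Rightarrow> nat \<Rightarrow> ('a list \<Rightarrow> int) \<Rightarrow> 'a set set \<Rightarrow> bool" where
  "supported_on E d f \<B> \<longleftrightarrow>
     (\<forall>S. S \<subseteq> E \<and> card S = d \<longrightarrow> (f (sorted_list_of_set S) \<noteq> 0 \<longleftrightarrow> S \<in> \<B>))"

text \<open>
  For \<open>f\<close> alternating on \<open>d\<close>-tuples and \<open>\<B>\<close> a family of \<open>d\<close>-subsets, this is the alternating map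
  that agrees with \<open>f\<close> on the members of \<open>\<B>\<close> and is 0 on all other \<open>d\<close>-subsets: it depends
  on the underlying set of a tuple only through membership in \<open>\<B>\<close>, so it inherits the signs
  of \<open>f\<close> under permutation of the entries.
\<close>

definition restrict_to_bases :: "('a list \<Rightarrow> int) \<Rightarrow> 'a set set \<Rightarrow> 'a list \<Rightarrow> int" where
  "restrict_to_bases f \<B> xs = (if set xs \<in> \<B> then f xs else 0)"

end

theory Submission
  imports Defs
begin

text \<open>
  The subdivision enters only through the three-term relations. For a set \<open>S\<close> of size \<open>d - 2\<close>
  and a disjoint four-element set \<open>F\<close>, let \<open>q\<close> be the indicator vector of \<open>S\<close> plus half that of
  \<open>F\<close>. If some term of the three-term relation on \<open>(S, F)\<close> is non-zero, then \<open>q\<close> is the midpoint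
  of two vertices of the matroid polytope of \<open>M\<close>, hence \<open>q\<close> lies in the polytope of some \<open>M\<^sub>i\<close>, and
  averaging shows that \<open>M\<^sub>i\<close> also contains a pair of bases \<open>S \<union> U\<close> and \<open>S \<union> (F - U)\<close>. So the
  three-term relation of \<open>\<chi>\<^sub>i\<close> has a non-zero term, thus terms of both signs, and these are
  also terms of the relation of \<open>\<chi>\<close>.

  The three-term relations imply all exchange relations because the support is a matroid. Suppose
  that the relation for \<open>(X, Y)\<close> fails, with \<open>|X - Y|\<close> minimal and non-zero term at \<open>a \<in> Y\<close>.
  For \<open>x \<in> X - Y\<close> the contraction by \<open>X - {x}\<close> has rank two and behaves like a configuration of
  vectors in the plane; the relations for \<open>X - {x} \<union> {y}\<close>, \<open>y \<in> Y\<close>, hold by minimality and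
  force the relevant elements of \<open>Y\<close> to be parallel there. Hence \<open>a\<close> and some other \<open>b \<in> Y\<close> are
  parallel in the contraction by \<open>X \<inter> Y\<close>, and then the terms at \<open>a\<close> and \<open>b\<close> cancel.
\<close>

section \<open>Basis exchange\<close>

lemma matroid_exchange:
  assumes "matroid E \<B>" "A \<in> \<B>" "B \<in> \<B>" "x \<in> A - B"
  obtains y where "y \<in> B - A" "insert y (A - {x}) \<in> \<B>"
  using assms unfolding matroid_def by blast

text \<open>Exchanging an element of \<open>A - B\<close> for one of \<open>B - A\<close> keeps the
  size of \<open>A\<close> and shrinks \<open>A - B\<close>. Once \<open>A - B\<close> is empty, so
  is \<open>B - A\<close>, as an exchange starting from \<open>B\<close> would need an element of
  \<open>A - B\<close>.\<close>

lemma matroid_bases_card_eq: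
  assumes "matroid E \<B>" "A \<in> \<B>" "B \<in> \<B>"
  shows "card A = card B"
  using assms(2)
proof (induction "card (A - B)" arbitrary: A rule: less_induct)
  case less
  have fin: "finite A" "finite B"
    using assms less.prems unfolding matroid_def by (meson finite_subset)+
  show ?case
  proof (cases "A - B = {}")
    case True
    have "B - A = {}"
      using assms less.prems True unfolding matroid_def by blast
    with True show ?thesis by (metis Diff_eq_empty_iff subset_antisym)
  next
    case False
    then obtain x where x: "x \<in> A - B" by blast
    then obtain y where y: "y \<in> B - A" "insert y (A - {x}) \<in> \<B>"
      using assms less.prems unfolding matroid_def by blast
    have "insert y (A - {x}) - B \<subset> A - B" using x y by auto
    then have "card (insert y (A - {x}) - B) < card (A - B)"
      using fin by (intro psubset_card_mono) auto
    then have "card (insert y (A - {x})) = card B" using less.hyps y by blast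
    moreover have "card (insert y (A - {x})) = card A"
      using x y fin by (simp add: card.insert_remove card_Suc_Diff1 del: card_Diff_insert)
    ultimately show ?thesis by simp
  qed
qed

text \<open>Here the incoming element is prescribed instead of the outgoing one. Starting from
  \<open>B\<close>, all elements outside \<open>A\<close> other than \<open>y\<close> are exchanged
  for elements of \<open>A\<close>; a basis \<open>D\<close> with \<open>D - A = {y}\<close> has the
  size of \<open>A\<close>, hence is \<open>insert y (A - {x})\<close>. Keeping
  \<open>A \<inter> B\<close> inside \<open>D\<close> ensures that \<open>x\<close> is not in
  \<open>B\<close>.\<close>

lemma matroid_dual_exchange:
  assumes m: "matroid E \<B>" and A: "A \<in> \<B>" and B: "B \<in> \<B>" and y: "y \<in> B - A"
  obtains x where "x \<in> A - B" "insert y (A - {x}) \<in> \<B>"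
proof -
  have "\<exists>x\<in>A - B. insert y (A - {x}) \<in> \<B>"
    if "D \<in> \<B>" "y \<in> D" "A \<inter> B \<subseteq> D" for D
    using that
  proof (induction "card (D - A)" arbitrary: D rule: less_induct)
    case less
    have fin: "finite A" "finite D"
      using m A less.prems unfolding matroid_def by (meson finite_subset)+
    show ?case
    proof (cases "D - A = {y}")
      case True
      have card: "card D = card A" using matroid_bases_card_eq m A less.prems by blast
      have "A - D \<noteq> {}"
      proof
        assume "A - D = {}"
        then have "A \<subset> D" using True by blast
        then show False using psubset_card_mono[of D A] fin card by simp
      qed
      then obtain x where x: "x \<in> A - D" by blast
      have "D \<subseteq> insert y (A - {x})" using True x by blast
      moreover have "card (insert y (A - {x})) = card A"
        using x y fin by (simp add: card.insert_remove card_Suc_Diff1 del: card_Diff_insert)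
      ultimately have "D = insert y (A - {x})"
        using card fin by (intro card_subset_eq) auto
      then show ?thesis using x less.prems by blast
    next
      case False
      then obtain z where z: "z \<in> D - A" "z \<noteq> y" using less.prems y by blast
      then obtain w where w: "w \<in> A - D" "insert w (D - {z}) \<in> \<B>"
        using m A less.prems unfolding matroid_def by blast
      have "insert w (D - {z}) - A \<subset> D - A" using z w by auto
      then have "card (insert w (D - {z}) - A) < card (D - A)"
        using fin by (intro psubset_card_mono) auto
      then show ?thesis
        using less.hyps[of "insert w (D - {z})"] w z less.prems by blast
    qed
  qed
  then show thesis using that B y by blast
qed

section \<open>Balanced sets of signs\<close>

text \<open>The sign condition of a chirotope exchange relation, imposed on the set of its terms, so
  that order, repetition and zero terms do not matter.\<close>

definition balanced :: "int set \<Rightarrow> bool" where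
  "balanced A \<longleftrightarrow> (\<exists>u\<in>A. u > 0) \<and> (\<exists>u\<in>A. u < 0) \<or> (\<forall>u\<in>A. u = 0)"

lemma balanced_scale:
  assumes "balanced A"
  shows "balanced ((*) c ` A)"
proof (cases c "0 :: int" rule: linorder_cases)
  case less
  then show ?thesis using assms unfolding balanced_def
    by (auto simp: mult_neg_neg mult_neg_pos mult_less_0_iff zero_less_mult_iff)
next
  case equal
  then show ?thesis unfolding balanced_def by auto
next
  case greater
  then show ?thesis using assms unfolding balanced_def
    by (auto simp: mult_less_0_iff zero_less_mult_iff)
qed

text \<open>An unbalanced set has non-zero elements of one sign only; \<open>\<epsilon>\<close>
  normalises that sign to be positive.\<close>

lemma balancedI_sgn:
  fixes A :: "int set"
  assumes "\<And>\<epsilon> u. \<epsilon> \<in> {1, -1} \<Longrightarrow> u \<in> A \<Longrightarrow> \<epsilon> * u > 0 \<Longrightarrow> (\<forall>v\<in>A. \<epsilon> * v \<ge> 0) \<Longrightarrow> False"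
  shows "balanced A"
proof (rule ccontr)
  assume nb: "\<not> balanced A"
  then obtain u where u: "u \<in> A" "u \<noteq> 0" unfolding balanced_def by blast
  show False
  proof (cases "u > 0")
    case True
    with nb u have "\<forall>v\<in>A. v \<ge> 0" unfolding balanced_def by (meson not_le)
    then show False using assms[of 1 u] u True by simp
  next
    case False
    with nb u have "\<forall>v\<in>A. v \<le> 0" unfolding balanced_def by (meson linorder_neqE not_le)
    then show False using assms[of "-1" u] u False by simp
  qed
qed

text \<open>A three-term relation with a vanishing term becomes an equation, since two signs whose
  difference must balance are equal.\<close>

lemma balanced_triple_zero:
  assumes "balanced {0, - u, v}" "u \<in> {1, -1, 0}" "v \<in> {1, -1, 0 :: int}"
  shows "u = v"
  using assms unfolding balanced_def by auto

text \<open>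
  Think of \<open>g i j\<close> and \<open>h i\<close> as the signs of the determinants \<open>[u\<^sub>i, u\<^sub>j]\<close> and \<open>[x, u\<^sub>i]\<close> of plane
  vectors. All \<open>u\<^sub>i\<close> lie on one side of the line of \<open>x\<close>, so an \<open>u\<^sub>m\<close> of extreme angle has all others
  on one side, and balance at \<open>m\<close> makes them parallel to \<open>u\<^sub>m\<close>.
\<close>

lemma rank_two_orthogonality:
  fixes g :: "'i \<Rightarrow> 'i \<Rightarrow> int" and h :: "'i \<Rightarrow> int"
  assumes fin: "finite J"
    and anti: "\<And>i j. g i j = - g j i"
    and h: "\<And>i. i \<in> J \<Longrightarrow> h i \<ge> 0" and i0: "i0 \<in> J" "h i0 > 0"
    and gp: "\<And>i j k. i \<in> J \<Longrightarrow> j \<in> J \<Longrightarrow> k \<in> J \<Longrightarrow>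
      balanced {h i * g j k, - (h j * g i k), h k * g i j}"
    and orth: "\<And>i. i \<in> J \<Longrightarrow> balanced (g i ` J)"
    and ij: "i \<in> J" "j \<in> J"
  shows "g i j = 0"
proof -
  define P where "P = {i\<in>J. h i > 0}"
  have finP: "finite P" and neP: "P \<noteq> {}" using fin i0 unfolding P_def by auto
  have PJ: "i \<in> J" "h i > 0" if "i \<in> P" for i using that unfolding P_def by auto
  \<comment> \<open>The balanced triple has positive coefficients \<open>h\<close>, so a negative
    \<open>g i k\<close> would make its middle term positive with no negative term to offset
    it.\<close>
  have trans: "g i k \<ge> 0" if "i \<in> P" "j \<in> P" "k \<in> P" "g i j \<ge> 0" "g j k \<ge> 0" for i j k
    using gp[OF PJ(1)[OF that(1)] PJ(1)[OF that(2)] PJ(1)[OF that(3)]]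
      PJ(2)[OF that(1)] PJ(2)[OF that(2)] PJ(2)[OF that(3)] that(4,5) unfolding balanced_def
    by (auto simp: mult_less_0_iff zero_less_mult_iff not_less)
  have zz: "g k l = 0" if "k \<in> J" "l \<in> J" "k \<notin> P" "l \<notin> P" for k l
  proof -
    have "h k = 0" "h l = 0" using that h[of k] h[of l] unfolding P_def by auto
    then show ?thesis using gp[of i0 k l] i0 that unfolding balanced_def
      by (auto simp: mult_less_0_iff zero_less_mult_iff)
  qed
  \<comment> \<open>With \<open>h k = 0\<close>, the vector at \<open>k\<close> is parallel to
    \<open>x\<close>, so all of \<open>P\<close> lies on one side of it. If \<open>g k i\<close>
    were non-zero, row \<open>k\<close> would have a single sign on \<open>P\<close> and zeros
    elsewhere, against its balance.\<close>
  have zP: "g k i = 0" if k: "k \<in> J" "k \<notin> P" and i: "i \<in> P" for k i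
  proof (rule ccontr)
    assume nz: "g k i \<noteq> 0"
    have hk: "h k = 0" using k h[of k] unfolding P_def by auto
    have same: "sgn (g k j) = sgn (g k i)" if j: "j \<in> P" for j
      using gp[of k i j] hk PJ[OF i] PJ[OF j] k anti[of k i] anti[of k j] nz unfolding balanced_def
      by (auto simp: sgn_if mult_less_0_iff zero_less_mult_iff)
    have *: "sgn (g k j) \<in> {0, sgn (g k i)}" if "j \<in> J" for j
      using zz[of k j] same[of j] k that by (cases "j \<in> P") auto
    show False
      using orth[OF k(1)] * PJ[OF i] nz unfolding balanced_def
      by (force simp: sgn_if split: if_splits)
  qed
  have "\<exists>m\<in>A. \<forall>j\<in>A. g m j \<ge> 0" if "finite A" "A \<noteq> {}" "A \<subseteq> P" for A
    using that
  proof (induction A rule: finite_ne_induct)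
    case (singleton x)
    then show ?case using anti[of x x] by simp
  next
    case (insert x A)
    then obtain m where m: "m \<in> A" "\<forall>j\<in>A. g m j \<ge> 0" by auto
    show ?case
    proof (cases "g m x \<ge> 0")
      case True
      then show ?thesis using m by auto
    next
      case False
      then have "g x m \<ge> 0" using anti[of x m] by simp
      then have "\<forall>j\<in>A. g x j \<ge> 0" using trans[of x m] m insert.prems by auto
      then show ?thesis using anti[of x x] by auto
    qed
  qed
  then obtain m where m: "m \<in> P" "\<forall>j\<in>P. g m j \<ge> 0" using finP neP by blast
  have "g m j \<ge> 0" if "j \<in> J" for j
    using m zP[of j m] anti[of m j] that by (cases "j \<in> P") auto
  then have gm: "g m j = 0" if "j \<in> J" for j
    using orth[OF PJ(1)[OF m(1)]] that unfolding balanced_def by force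
  have PP: "g j k = 0" if "j \<in> P" "k \<in> P" for j k
    using gp[OF PJ(1)[OF m(1)] PJ(1)[OF that(1)] PJ(1)[OF that(2)]]
      gm[OF PJ(1)[OF that(1)]] gm[OF PJ(1)[OF that(2)]] PJ(2)[OF m(1)] unfolding balanced_def
    by (auto simp: mult_less_0_iff zero_less_mult_iff)
  show ?thesis
    using PP zz zP[of i j] zP[of j i] anti[of i j] ij by (cases "i \<in> P"; cases "j \<in> P") auto
qed

section \<open>Alternating sign maps supported on the bases of a matroid\<close>

locale signed_bases =
  fixes E :: "'a set" and \<B> :: "'a set set" and d :: nat and f :: "'a list \<Rightarrow> int"
  assumes mat: "matroid E \<B>"
    and card_basis: "B \<in> \<B> \<Longrightarrow> card B = d"
    and alt: "alternating_sign_map E d f"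
    and supp: "xs \<in> tuples E d \<Longrightarrow> f xs \<noteq> 0 \<longleftrightarrow> set xs \<in> \<B>"
begin

lemma f_signs: "xs \<in> tuples E d \<Longrightarrow> f xs \<in> {1, -1, 0}"
  using alt unfolding alternating_sign_map_def by blast

lemma f_nondistinct: "xs \<in> tuples E d \<Longrightarrow> \<not> distinct xs \<Longrightarrow> f xs = 0"
  using alt unfolding alternating_sign_map_def by blast

text \<open>A permutation of the prefix fixes all later positions, so one sign \<open>s\<close>
  serves every tail \<open>ts\<close>. This uniformity allows values with different last entries to
  be compared.\<close>

lemma f_prefix_perm:
  assumes "mset xs = mset xs'" "set xs \<subseteq> E"
  obtains s where "s \<in> {1, -1}"
    "\<And>ts. length xs + length ts = d \<Longrightarrow> set ts \<subseteq> E \<Longrightarrow> f (xs @ ts) = s * f (xs' @ ts)"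
proof -
  obtain p where p: "p permutes {..<length xs'}" "permute_list p xs' = xs"
    using mset_eq_permutation[OF assms(1)] .
  show thesis
  proof (rule that[of "sign p"])
    show "sign p \<in> {1, -1 :: int}" by (simp add: sign_def)
    fix ts assume ts: "length xs + length ts = d" "set ts \<subseteq> E"
    have len: "length xs' = length xs" using mset_eq_length[OF assms(1)] by simp
    have "permute_list p (xs' @ ts) = xs @ ts"
    proof (rule nth_equalityI)
      fix i assume i: "i < length (permute_list p (xs' @ ts))"
      have pn: "permute_list p (xs' @ ts) ! i = (xs' @ ts) ! p i"
        using i by (simp add: permute_list_def)
      show "permute_list p (xs' @ ts) ! i = (xs @ ts) ! i"
      proof (cases "i < length xs'")
        case True
        then have "p i < length xs'" using permutes_in_image[OF p(1)] by auto
        then have "(xs' @ ts) ! p i = permute_list p xs' ! i"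
          using True by (simp add: nth_append permute_list_def)
        then show ?thesis using pn True p(2) len by (simp add: nth_append)
      next
        case False
        then have "p i = i" using p(1) unfolding permutes_def by auto
        then show ?thesis using pn False len by (simp add: nth_append)
      qed
    qed (simp add: len)
    moreover have "p permutes {..<d}"
      using permutes_subset[OF p(1)] ts len by auto
    moreover have "xs' @ ts \<in> tuples E d"
      using ts len assms mset_eq_setD[OF assms(1)] by (auto simp: tuples_def)
    ultimately show "f (xs @ ts) = sign p * f (xs' @ ts)"
      using alt unfolding alternating_sign_map_def by metis
  qed
qed

lemma f_swap:
  assumes "us @ [a, b] @ vs \<in> tuples E d"
  shows "f (us @ [b, a] @ vs) = - f (us @ [a, b] @ vs)"
proof -
  define p where "p = Transposition.transpose (length us) (Suc (length us))"
  have "permute_list p (us @ [a, b] @ vs) = us @ [b, a] @ vs"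
  proof (rule nth_equalityI)
    fix i assume "i < length (permute_list p (us @ [a, b] @ vs))"
    then have "permute_list p (us @ [a, b] @ vs) ! i = (us @ [a, b] @ vs) ! p i"
      by (simp add: permute_list_def del: upt_Suc)
    moreover consider "i < length us" | "i = length us" | "i = Suc (length us)"
      | k where "i = length us + Suc (Suc k)"
      by (metis add_Suc_right less_imp_Suc_add linorder_neqE_nat add.right_neutral not0_implies_Suc)
    ultimately show "permute_list p (us @ [a, b] @ vs) ! i = (us @ [b, a] @ vs) ! i"
      by cases (auto simp: p_def Transposition.transpose_def nth_append)
  qed simp
  moreover have "p permutes {..<d}"
    unfolding p_def using assms by (intro permutes_swap_id) (auto simp: tuples_def)
  moreover have "sign p = (-1 :: int)" unfolding p_def by (simp add: sign_swap_id)
  ultimately show ?thesis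
    using alt assms unfolding alternating_sign_map_def by (metis mult_minus1)
qed

lemma f_move_to_end:
  assumes "us @ b # vs \<in> tuples E d"
  shows "f (us @ b # vs) = (-1) ^ length vs * f (us @ vs @ [b])"
  using assms
proof (induction vs arbitrary: us)
  case (Cons v vs)
  have "f (us @ b # v # vs) = - f ((us @ [v]) @ b # vs)"
    using f_swap[of us v b vs] Cons.prems by (simp add: tuples_def)
  then show ?case using Cons.IH[of "us @ [v]"] Cons.prems by (simp add: tuples_def)
qed simp

text \<open>Positions count from 0 here, whereas \<open>exchange_term\<close> counts from 1.\<close>

abbreviation omit :: "'a list \<Rightarrow> nat \<Rightarrow> 'a list" where
  "omit ys k \<equiv> take k ys @ drop (Suc k) ys"

lemma omit_tuples: "ys \<in> tuples E (d + 1) \<Longrightarrow> k \<le> d \<Longrightarrow> omit ys k \<in> tuples E d"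
  by (auto simp: tuples_def dest: in_set_takeD in_set_dropD)

lemma set_omit:
  assumes "distinct ys" "k < length ys"
  shows "set (omit ys k) = set ys - {ys ! k}"
proof -
  have "distinct (take k ys @ ys ! k # drop (Suc k) ys)"
    using assms id_take_nth_drop[of k ys] by metis
  moreover have "set ys = set (take k ys @ ys ! k # drop (Suc k) ys)"
    using assms id_take_nth_drop[of k ys] by metis
  ultimately show ?thesis by auto
qed

text \<open>In each omitted tuple the remaining one of the two entries is moved to the end. Moving
  \<open>ys ! i\<close> passes the \<open>j - i - 1\<close> intermediate entries in addition to
  those after \<open>j\<close>; together with \<open>(-1) ^ i\<close> and \<open>(-1) ^ j\<close>
  this leaves opposite signs.\<close>

lemma omit_two:
  assumes ys: "ys \<in> tuples E (d + 1)" and ij: "i < j" "j \<le> d"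
  obtains ws s where "mset ys = mset (ws @ [ys ! i, ys ! j])" "s \<in> {1, -1}"
    "(-1) ^ i * f (omit ys i) = s * f (ws @ [ys ! j])"
    "(-1) ^ j * f (omit ys j) = - s * f (ws @ [ys ! i])"
proof -
  define us vs ts a b where
    "us = take i ys" and "vs = take (j - Suc i) (drop (Suc i) ys)" and "ts = drop (Suc j) ys"
    and "a = ys ! i" and "b = ys ! j"
  have len: "length ys = d + 1" using ys by (simp add: tuples_def)
  have 1: "drop (Suc i) ys = vs @ b # ts"
    using id_take_nth_drop[of "j - Suc i" "drop (Suc i) ys"] ij len
    by (simp add: vs_def ts_def b_def)
  have 2: "ys = us @ a # vs @ b # ts"
    using id_take_nth_drop[of i ys] ij len 1 by (simp add: us_def a_def)
  have lu: "length us = i" using ij len by (simp add: us_def)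
  have lv: "length vs = j - Suc i" using ij len by (simp add: vs_def)
  have oi: "omit ys i = (us @ vs) @ b # ts" using 1 by (simp add: us_def)
  have oj: "omit ys j = us @ a # (vs @ ts)"
  proof -
    have "j - i = Suc (length vs)" "Suc j - i = Suc (Suc (length vs))" using ij lv by auto
    then show ?thesis using ij lu by (subst (1 2) 2) simp
  qed
  have e: "f ((us @ vs) @ b # ts) = (-1) ^ length ts * f ((us @ vs) @ ts @ [b])"
    using omit_tuples[OF ys, of i] ij oi by (intro f_move_to_end) simp
  have e': "f (us @ a # (vs @ ts)) = (-1) ^ length (vs @ ts) * f (us @ (vs @ ts) @ [a])"
    using omit_tuples[OF ys, of j] ij oj by (intro f_move_to_end) simp
  have j: "j = Suc (i + length vs)" using lv ij by simp
  show thesis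
  proof (rule that[of "us @ vs @ ts" "(-1) ^ (i + length ts)"])
    show "mset ys = mset ((us @ vs @ ts) @ [ys ! i, ys ! j])"
      unfolding a_def[symmetric] b_def[symmetric] by (subst 2) simp
    show "(- 1) ^ (i + length ts) \<in> {1, - 1 :: int}"
      by (cases "even (i + length ts)") auto
    show "(-1) ^ i * f (omit ys i) = (-1) ^ (i + length ts) * f ((us @ vs @ ts) @ [ys ! j])"
      unfolding oi e b_def[symmetric] by (simp add: power_add)
    have "(-1) ^ j * (-1) ^ length (vs @ ts) = - ((-1) ^ (i + length ts) :: int)"
      unfolding j by (simp add: power_add flip: power_mult_distrib)
    then show "(-1) ^ j * f (omit ys j) = - ((-1) ^ (i + length ts)) * f ((us @ vs @ ts) @ [ys ! i])"
      unfolding oj e' a_def[symmetric] by (simp add: mult.assoc[symmetric])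
  qed
qed

end

section \<open>From three-term relations to all exchange relations\<close>

locale three_term_bases = signed_bases +
  assumes three_term: "length zs + 2 = d \<Longrightarrow> set zs \<subseteq> E \<Longrightarrow> {a, b, c, e} \<subseteq> E \<Longrightarrow>
    balanced {f (zs @ [a, b]) * f (zs @ [c, e]), - (f (zs @ [a, c]) * f (zs @ [b, e])),
      f (zs @ [a, e]) * f (zs @ [b, c])}"
begin

lemma f_mult_signs:
  "xs \<in> tuples E d \<Longrightarrow> ys \<in> tuples E d \<Longrightarrow> f xs * f ys \<in> {1, -1, 0}"
  using f_signs[of xs] f_signs[of ys] by auto

text \<open>
  \<open>a\<close> and \<open>b\<close> are parallel after contracting \<open>set xs \<inter> set ws\<close>; each exchange step turning \<open>ws\<close>
  towards \<open>xs\<close> preserves the ratio of the values at \<open>a\<close> and \<open>b\<close>, by a three-term relation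
  in which one term vanishes.
\<close>

lemma parallel_elements:
  assumes par: "\<And>T. set xs \<inter> set ws \<subseteq> T \<Longrightarrow> insert a (insert b T) \<notin> \<B>"
    and ab: "a \<in> E" "b \<in> E"
    and xs: "length xs + 1 = d" "set xs \<subseteq> E" "insert a (set xs) \<in> \<B>"
    and ws: "length ws + 1 = d" "set ws \<subseteq> E" "insert b (set ws) \<in> \<B>"
  shows "f (xs @ [a]) * f (ws @ [b]) = f (xs @ [b]) * f (ws @ [a])"
  using par ws
proof (induction "card (set ws - set xs)" arbitrary: ws rule: less_induct)
  case less
  have dist: "distinct ys \<and> y \<notin> set ys" if "insert y (set ys) \<in> \<B>" "length ys + 1 = d" for y ys
  proof -
    have "card (set (y # ys)) = length (y # ys)" using card_basis[OF that(1)] that(2) by simp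
    then have "distinct (y # ys)" by (rule card_distinct)
    then show ?thesis by simp
  qed
  have dw: "distinct ws" "b \<notin> set ws" using dist less.prems by blast+
  have dx: "distinct xs" "a \<notin> set xs" using dist xs by blast+
  show ?case
  proof (cases "set ws \<subseteq> set xs")
    case True
    have "set ws = set xs"
      using True dw dx xs less.prems by (intro card_subset_eq) (auto simp: distinct_card)
    then have "mset ws = mset xs" using dw dx by (simp add: set_eq_iff_mset_eq_distinct)
    then obtain s where "\<And>ts. length ws + length ts = d \<Longrightarrow> set ts \<subseteq> E \<Longrightarrow> f (ws @ ts) = s * f (xs @ ts)"
      using f_prefix_perm less.prems by metis
    then have "f (ws @ [b]) = s * f (xs @ [b])" "f (ws @ [a]) = s * f (xs @ [a])"
      using less.prems ab by auto
    then show ?thesis by simp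
  next
    case False
    then obtain z where z: "z \<in> set ws" "z \<notin> set xs" by blast
    have za: "z \<noteq> a" using less.prems(1)[of "set ws"] less.prems(4) z by (auto simp: insert_absorb)
    have zb: "z \<noteq> b" using z dw by blast
    have "z \<in> insert b (set ws) - insert a (set xs)" using z za by blast
    then obtain x where x: "x \<in> insert a (set xs) - insert b (set ws)"
      "insert x (insert b (set ws) - {z}) \<in> \<B>"
      by (rule matroid_exchange[OF mat less.prems(4) xs(3)])
    have "insert b (set ws) - {z} = insert b (set ws - {z})" using zb by blast
    then have xB: "insert x (insert b (set ws - {z})) \<in> \<B>" using x by simp
    \<comment> \<open>Otherwise \<open>a\<close> and \<open>b\<close> would complete
      \<open>set ws - {z}\<close> to a basis, although this set contains
      \<open>set xs \<inter> set ws\<close>.\<close>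
    then have "x \<noteq> a" using less.prems(1)[of "set ws - {z}"] z by blast
    then have xx: "x \<in> set xs" "x \<notin> set ws" "x \<noteq> b" using x by auto
    define us where "us = remove1 z ws"
    have us: "mset ws = mset (us @ [z])" "set us = set ws - {z}" "length us + 2 = d"
      using z dw less.prems
      by (auto simp: us_def length_remove1 set_remove1_eq) (metis Suc_pred length_pos_if_in_set)
    obtain s where s: "\<And>ts. length ws + length ts = d \<Longrightarrow> set ts \<subseteq> E \<Longrightarrow>
        f (ws @ ts) = s * f ((us @ [z]) @ ts)"
      using f_prefix_perm[OF us(1)] less.prems by metis
    have E: "set us \<subseteq> E" "x \<in> E" "z \<in> E" using us less.prems z xx xs by auto
    have IH: "f (xs @ [a]) * f ((us @ [x]) @ [b]) = f (xs @ [b]) * f ((us @ [x]) @ [a])"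
    proof (rule less.hyps)
      have "set (us @ [x]) - set xs \<subset> set ws - set xs" using us z xx by auto
      then show "card (set (us @ [x]) - set xs) < card (set ws - set xs)"
        by (intro psubset_card_mono) auto
      show "insert a (insert b T) \<notin> \<B>" if "set xs \<inter> set (us @ [x]) \<subseteq> T" for T
        using that us z by (intro less.prems(1)) auto
      show "length (us @ [x]) + 1 = d" "set (us @ [x]) \<subseteq> E" using us E by auto
      show "insert b (set (us @ [x])) \<in> \<B>" using xB us by (simp add: insert_commute)
    qed
    have tup: "us @ [p, q] \<in> tuples E d" if "p \<in> E" "q \<in> E" for p q
      using that us E by (auto simp: tuples_def)
    have sw: "f (us @ [p, q]) = - f (us @ [q, p])" if "p \<in> E" "q \<in> E" for p q
      using f_swap[of us q p "[]"] tup that by simp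
    \<comment> \<open>This is the vanishing term that turns the three-term relation on
      \<open>a, b, z, x\<close> into an equation.\<close>
    have "f (us @ [a, b]) = 0"
      using supp[OF tup[OF ab]] less.prems(1)[of "set us"] us z by auto
    then have "f (us @ [a, z]) * f (us @ [b, x]) = f (us @ [a, x]) * f (us @ [b, z])"
      using three_term[of us a b z x] us E ab tup
      by (intro balanced_triple_zero f_mult_signs) auto
    then have eq: "f (us @ [z, a]) * f (us @ [x, b]) = f (us @ [x, a]) * f (us @ [z, b])"
      using sw[of a z] sw[of b x] sw[of a x] sw[of b z] ab E by simp
    \<comment> \<open>This value is the common factor to be cancelled after combining the induction
      hypothesis with \<open>eq\<close>.\<close>
    have nz: "f (us @ [x, b]) \<noteq> 0"
      using supp[OF tup, of x b] E ab xB us by (auto simp: insert_commute)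
    have "f (us @ [x, b]) * (f (xs @ [a]) * f (us @ [z, b])) =
        f (us @ [x, b]) * (f (xs @ [b]) * f (us @ [z, a]))"
      using IH eq by (simp add: algebra_simps)
    then have "f (xs @ [a]) * f (us @ [z, b]) = f (xs @ [b]) * f (us @ [z, a])" using nz by simp
    then show ?thesis using s[of "[a]"] s[of "[b]"] less.prems ab by simp
  qed
qed

text \<open>Strong induction on \<open>card (set xs - set ys)\<close>. In a failing relation the
  terms, multiplied by a suitable \<open>\<epsilon>\<close>, are all non-negative and one is
  positive, at \<open>i0\<close>. The contradiction sought is a second position carrying the
  negative of that term.\<close>

lemma exchange_balanced:
  assumes "length xs + 1 = d" "set xs \<subseteq> E" and ys: "ys \<in> tuples E (d + 1)"
  shows "balanced ((\<lambda>k. f (xs @ [ys ! k]) * ((-1) ^ k * f (omit ys k))) ` {..d})"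
  using assms(1,2)
proof (induction "card (set xs - set ys)" arbitrary: xs rule: less_induct)
  case less
  define c where "c k = (-1) ^ k * f (omit ys k)" for k
  define t where "t k = f (xs @ [ys ! k]) * c k" for k
  have leny: "length ys = d + 1" and ysE: "set ys \<subseteq> E" using ys by (auto simp: tuples_def)
  have yE: "ys ! k \<in> E" if "k \<le> d" for k using ysE leny that by (auto intro: nth_mem)
  have xtup: "xs @ [y] \<in> tuples E d" if "y \<in> E" for y
    using less.prems that by (auto simp: tuples_def)
  have xB: "f (xs @ [y]) \<noteq> 0 \<longleftrightarrow> insert y (set xs) \<in> \<B>" if "y \<in> E" for y
    using supp[OF xtup[OF that]] by simp
  have c_nz: "c k \<noteq> 0 \<longleftrightarrow> set (omit ys k) \<in> \<B>" if "k \<le> d" for k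
    using supp[OF omit_tuples[OF ys that]] unfolding c_def by simp
  have "balanced (t ` {..d})"
  proof (rule balancedI_sgn)
    fix \<epsilon> u assume \<epsilon>: "\<epsilon> \<in> {1, -1}" and "u \<in> t ` {..d}" and u: "\<epsilon> * u > 0"
      and "\<forall>v\<in>t ` {..d}. \<epsilon> * v \<ge> 0"
    then have nn: "\<And>k. k \<le> d \<Longrightarrow> \<epsilon> * t k \<ge> 0" by auto
    from \<open>u \<in> t ` {..d}\<close> obtain i0 where i0: "i0 \<le> d" "u = t i0" by auto
    define a where "a = ys ! i0"
    have aE: "a \<in> E" unfolding a_def using yE i0 by simp
    have "t i0 \<noteq> 0" using u i0 by auto
    then have nz: "f (xs @ [a]) \<noteq> 0" "c i0 \<noteq> 0" unfolding t_def a_def by auto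
    have xaB: "insert a (set xs) \<in> \<B>" using nz xB aE by simp
    have dx: "distinct xs" "a \<notin> set xs"
      using f_nondistinct[OF xtup[OF aE]] nz by auto
    \<comment> \<open>If \<open>f\<close> has the same ratio at \<open>a\<close> and
      \<open>ys ! j\<close> behind \<open>xs\<close> as behind the remaining entries of
      \<open>ys\<close>, the opposite signs in \<open>omit_two\<close> give
      \<open>t j = - t i0\<close>.\<close>
    have no_pair: False if j: "j \<le> d" "j \<noteq> i0"
      and eq: "\<And>ws. mset ys = mset (ws @ [a, ys ! j]) \<Longrightarrow> insert (ys ! j) (set ws) \<in> \<B> \<Longrightarrow>
        f (xs @ [a]) * f (ws @ [ys ! j]) = f (xs @ [ys ! j]) * f (ws @ [a])" for j
    proof -
      have "\<exists>ws s. mset ys = mset (ws @ [a, ys ! j]) \<and> c i0 = s * f (ws @ [ys ! j]) \<and>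
          c j = - s * f (ws @ [a])"
      proof (cases "i0 < j")
        case True
        then show ?thesis using omit_two[OF ys True j(1)] unfolding c_def a_def by metis
      next
        case False
        then have "j < i0" using j by simp
        from omit_two[OF ys this i0(1)] obtain ws s where
          *: "mset ys = mset (ws @ [ys ! j, a])" "c j = s * f (ws @ [a])"
            "c i0 = - s * f (ws @ [ys ! j])" unfolding c_def a_def by metis
        show ?thesis by (rule exI[of _ ws], rule exI[of _ "- s"]) (use * in auto)
      qed
      then obtain ws s where w: "mset ys = mset (ws @ [a, ys ! j])" "c i0 = s * f (ws @ [ys ! j])"
          "c j = - s * f (ws @ [a])" by blast
      have "ws @ [ys ! j] \<in> tuples E d"
        using mset_eq_setD[OF w(1)] mset_eq_length[OF w(1)] leny ysE by (auto simp: tuples_def)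
      then have "insert (ys ! j) (set ws) \<in> \<B>" using supp w nz by fastforce
      from eq[OF w(1)] this have "f (xs @ [a]) * f (ws @ [ys ! j]) = f (xs @ [ys ! j]) * f (ws @ [a])"
        by blast
      then have "t j = - t i0" unfolding t_def w a_def[symmetric] by (simp add: algebra_simps)
      then show False using nn[OF j(1)] u i0 by simp
    qed
    \<comment> \<open>A second copy of \<open>a\<close> satisfies the ratio condition of
      \<open>no_pair\<close> trivially; any other repetition survives the omission of
      \<open>a\<close> and forces \<open>c i0 = 0\<close>.\<close>
    have dy: "distinct ys"
    proof (rule ccontr)
      assume "\<not> distinct ys"
      then obtain i j where ij: "i < j" "j \<le> d" "ys ! i = ys ! j"
        using leny by (auto simp: distinct_conv_nth) (metis less_Suc_eq_le linorder_neqE_nat)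
      show False
      proof (cases "i0 = i \<or> i0 = j")
        case True
        then have "\<exists>j'\<le>d. j' \<noteq> i0 \<and> ys ! j' = a"
          using ij i0 unfolding a_def by (cases "i0 = i") (force intro: exI[of _ j] exI[of _ i])+
        then obtain j' where "j' \<le> d" "j' \<noteq> i0" "ys ! j' = a" by blast
        then show False using no_pair[of j'] by simp
      next
        case False
        have "\<not> distinct (omit ys i0)"
        proof
          assume di: "distinct (omit ys i0)"
          have l: "length (omit ys i0) = d" using i0 leny by simp
          have n: "omit ys i0 ! (if k < i0 then k else k - 1) = ys ! k"
            if "k \<noteq> i0" "k \<le> d" for k
            using that i0 leny by (auto simp: nth_append)
          have "(if i < i0 then i else i - 1) = (if j < i0 then j else j - 1)"
            using di l n[of i] n[of j] ij i0 False
            by (intro nth_eq_iff_index_eq[OF di, THEN iffD1]) auto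
          then show False using ij False by (auto split: if_splits)
        qed
        then show False using f_nondistinct[OF omit_tuples[OF ys i0(1)]] nz unfolding c_def by simp
      qed
    qed
    have so: "set (omit ys k) = set ys - {ys ! k}" if "k \<le> d" for k
      using set_omit[OF dy] leny that by simp
    define J where "J = {k\<in>{..d}. c k \<noteq> 0}"
    have i0J: "i0 \<in> J" using i0 nz by (simp add: J_def)
    have line: "insert (ys ! i) (insert (ys ! j) (set xs - {x})) \<notin> \<B>"
      if x: "x \<in> set xs" "x \<notin> set ys" and ij: "i \<in> J" "j \<in> J" for x i j
    proof -
      define zs where "zs = remove1 x xs"
      have zs: "mset xs = mset (zs @ [x])" "set zs = set xs - {x}" "length zs + 2 = d"
        using x dx less.prems
        by (auto simp: zs_def length_remove1 set_remove1_eq) (metis Suc_pred length_pos_if_in_set)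
      obtain s where s: "s \<in> {1, -1}" "\<And>ts. length xs + length ts = d \<Longrightarrow> set ts \<subseteq> E \<Longrightarrow>
          f (xs @ ts) = s * f ((zs @ [x]) @ ts)"
        using f_prefix_perm[OF zs(1)] less.prems by metis
      have E: "set zs \<subseteq> E" "x \<in> E" using zs less.prems x by auto
      have tup: "zs @ [p, q] \<in> tuples E d" if "p \<in> E" "q \<in> E" for p q
        using that zs E by (auto simp: tuples_def)
      have sw: "f (zs @ [p, q]) = - f (zs @ [q, p])" if "p \<in> E" "q \<in> E" for p q
        using f_swap[of zs q p "[]"] tup that by simp
      have JE: "ys ! k \<in> E" "k \<le> d" if "k \<in> J" for k using that yE by (auto simp: J_def)
      \<comment> \<open>In the rank-two contraction by \<open>set zs\<close>, the vector of
        \<open>ys ! i\<close> is scaled by \<open>c i\<close>. Then \<open>h\<close> consists of the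
        terms of the failing relation times \<open>\<epsilon>\<close>, and row \<open>i\<close> of
        \<open>g\<close> is the relation for \<open>zs @ [ys ! i]\<close> times \<open>c i\<close>,
        balanced by induction. The value 0 outside \<open>J\<close> makes \<open>g\<close>
        antisymmetric on all indices.\<close>
      define g where "g i j = (if i \<in> J \<and> j \<in> J then c i * c j * f (zs @ [ys ! i, ys ! j]) else 0)" for i j
      define h where "h i = \<epsilon> * s * c i * f (zs @ [x, ys ! i])" for i
      have ht: "h i = \<epsilon> * t i" if "i \<in> J" for i
        using s(2)[of "[ys ! i]"] s(1) less.prems JE[OF that] unfolding h_def t_def by auto
      have "g i j = 0"
      proof (rule rank_two_orthogonality[where J = J and h = h and ?i0.0 = i0])
        show "finite J" by (simp add: J_def)
        show "g i j = - g j i" for i j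
          unfolding g_def using sw[of "ys ! i" "ys ! j"] JE by auto
        show "h i \<ge> 0" if "i \<in> J" for i using nn ht JE that by simp
        show "i0 \<in> J" by fact
        show "h i0 > 0" using ht[OF i0J] u i0 by simp
        show "balanced {h i * g j k, - (h j * g i k), h k * g i j}"
          if "i \<in> J" "j \<in> J" "k \<in> J" for i j k
          using balanced_scale[OF three_term[of zs x "ys ! i" "ys ! j" "ys ! k"],
              of "\<epsilon> * s * c i * c j * c k"] zs E JE that
          by (simp add: g_def h_def mult_ac)
        show "balanced (g i ` J)" if i: "i \<in> J" for i
        proof -
          have "set (zs @ [ys ! i]) - set ys \<subset> set xs - set ys"
            using zs x leny JE[OF i] by (auto intro!: nth_mem)
          then have "card (set (zs @ [ys ! i]) - set ys) < card (set xs - set ys)"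
            by (intro psubset_card_mono) auto
          then have "balanced ((\<lambda>k. f ((zs @ [ys ! i]) @ [ys ! k]) * ((-1) ^ k * f (omit ys k))) ` {..d})"
            using zs E JE[OF i] by (intro less.hyps) auto
          then have "balanced ((*) (c i) ` (\<lambda>k. f (zs @ [ys ! i, ys ! k]) * c k) ` {..d})"
            using balanced_scale by (simp add: c_def)
          moreover have "(*) (c i) ` (\<lambda>k. f (zs @ [ys ! i, ys ! k]) * c k) ` {..d} = g i ` {..d}"
            unfolding image_image using i by (intro image_cong) (auto simp: g_def J_def)
          ultimately have "balanced (g i ` {..d})" by simp
          moreover have "g i k = 0" if "k \<notin> J" for k using that by (simp add: g_def)
          moreover have "J \<subseteq> {..d}" by (auto simp: J_def)
          ultimately show ?thesis unfolding balanced_def by (auto simp: image_iff) (metis less_irrefl)+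
        qed
        show "i \<in> J" "j \<in> J" by fact+
      qed
      then have "f (zs @ [ys ! i, ys ! j]) = 0" using ij by (simp add: g_def J_def)
      then show ?thesis using supp[OF tup, of "ys ! i" "ys ! j"] JE ij zs by simp
    qed
    have ya: "set ys - {a} \<in> \<B>" using c_nz nz so i0 unfolding a_def by simp
    have "a \<in> set ys" unfolding a_def using i0 leny by simp
    \<comment> \<open>Bringing \<open>a\<close> into the basis \<open>set ys - {a}\<close> expels
      some \<open>b\<close> outside \<open>set xs\<close>, so \<open>set ys - {b}\<close> is a basis
      as well and the position of \<open>b\<close> lies in \<open>J\<close>.\<close>
    have "a \<in> insert a (set xs) - (set ys - {a})" by simp
    then obtain b where b: "b \<in> (set ys - {a}) - insert a (set xs)" "insert a (set ys - {a} - {b}) \<in> \<B>"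
      using matroid_dual_exchange[OF mat ya xaB] by blast
    then obtain j where j: "j \<le> d" "b = ys ! j" using leny by (auto simp: in_set_conv_nth less_Suc_eq_le)
    have "insert a (set ys - {a} - {b}) = set ys - {b}" using b \<open>a \<in> set ys\<close> by auto
    then have jJ: "j \<in> J" using c_nz[OF j(1)] so[OF j(1)] b j by (simp add: J_def)
    have ji: "j \<noteq> i0" using b j by (auto simp: a_def)
    \<comment> \<open>\<open>a\<close> and \<open>b\<close> are parallel in the contraction by \<open>X \<inter> Y\<close>\<close>
    have par: "insert a (insert b T) \<notin> \<B>" if T: "set xs \<inter> set ys \<subseteq> T" for T
    proof
      assume TB: "insert a (insert b T) \<in> \<B>"
      \<comment> \<open>Bringing \<open>b\<close> into \<open>insert a (set xs)\<close> expels an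
        \<open>x\<close> of \<open>set xs\<close> outside \<open>set ys\<close>; then
        \<open>a\<close> and \<open>b\<close> complete \<open>set xs - {x}\<close> to a basis, which
        \<open>line\<close> excludes.\<close>
      have "b \<in> insert a (insert b T) - insert a (set xs)" using b by blast
      then obtain x where x: "x \<in> insert a (set xs) - insert a (insert b T)"
        "insert b (insert a (set xs) - {x}) \<in> \<B>"
        using matroid_dual_exchange[OF mat xaB TB] by blast
      then have "x \<in> set xs" "x \<notin> set ys" "x \<noteq> a" using T by auto
      moreover have "insert a (set xs) - {x} = insert a (set xs - {x})" using \<open>x \<noteq> a\<close> by blast
      ultimately show False using line[OF _ _ jJ i0J, of x] x j unfolding a_def by simp
    qed
    show False
    proof (rule no_pair[OF j(1) ji])
      fix ws assume w: "mset ys = mset (ws @ [a, ys ! j])"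
        and B: "insert (ys ! j) (set ws) \<in> \<B>"
      have sy: "set ys = insert a (insert b (set ws))"
        using mset_eq_setD[OF w] j by auto
      have lw: "length ws + 1 = d" using mset_eq_length[OF w] leny by simp
      have "f (xs @ [a]) * f (ws @ [b]) = f (xs @ [b]) * f (ws @ [a])"
      proof (rule parallel_elements)
        show "insert a (insert b T) \<notin> \<B>" if "set xs \<inter> set ws \<subseteq> T" for T
          using that sy b dx by (intro par) auto
        show "b \<in> E" "set ws \<subseteq> E" using sy ysE by auto
        show "insert b (set ws) \<in> \<B>" using B j by simp
      qed (use aE less.prems xaB lw in auto)
      then show "f (xs @ [a]) * f (ws @ [ys ! j]) = f (xs @ [ys ! j]) * f (ws @ [a])" using j by simp
    qed
  qed
  then show ?case by (simp add: t_def c_def)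
qed

end

section \<open>Supports of alternating maps and three-term relations of chirotopes\<close>

lemma balanced_minus_zero: "balanced A \<longleftrightarrow> balanced (A - {0})"
  unfolding balanced_def by auto

text \<open>The support condition tests only increasing tuples. Sorting a distinct tuple changes
  \<open>f\<close> by a sign; for a tuple with repetitions \<open>f\<close> vanishes and the
  underlying set is too small to be a basis.\<close>

lemma alternating_nonzero_iff:
  fixes f :: "'e::linorder list \<Rightarrow> int"
  assumes alt: "alternating_sign_map E d f" and supp: "supported_on E d f \<B>"
    and card: "\<And>B. B \<in> \<B> \<Longrightarrow> card B = d" and xs: "xs \<in> tuples E d"
  shows "f xs \<noteq> 0 \<longleftrightarrow> set xs \<in> \<B>"
proof (cases "distinct xs")
  case True
  define ys where "ys = sorted_list_of_set (set xs)"
  have len: "length xs = d" "set xs \<subseteq> E" using xs by (auto simp: tuples_def)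
  have m: "mset xs = mset ys" using True by (simp add: ys_def set_eq_iff_mset_eq_distinct[symmetric])
  obtain p where p: "p permutes {..<length ys}" "permute_list p ys = xs"
    using mset_eq_permutation[OF m] .
  have "length ys = d" using len mset_eq_length[OF m] by simp
  moreover have "ys \<in> tuples E d" using len calculation by (simp add: ys_def tuples_def)
  ultimately have "f xs = sign p * f ys"
    using alt p unfolding alternating_sign_map_def by metis
  moreover have "f ys \<noteq> 0 \<longleftrightarrow> set xs \<in> \<B>"
    using supp len True distinct_card[OF True] unfolding supported_on_def ys_def by auto
  ultimately show ?thesis by (simp add: sign_def)
next
  case False
  then have "f xs = 0" using alt xs unfolding alternating_sign_map_def by blast
  moreover have "set xs \<notin> \<B>" using False card[of "set xs"] xs card_distinct by (auto simp: tuples_def)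
  ultimately show ?thesis by simp
qed

text \<open>In the exchange relation for \<open>zs @ [a]\<close> and \<open>zs @ [b, c, e]\<close>,
  the terms at entries of \<open>zs\<close> vanish by repetition; the other three are the claimed
  ones up to a common sign.\<close>

lemma chirotope_three_term:
  assumes ch: "chirotope E d f" and zs: "length zs + 2 = d" "set zs \<subseteq> E" and E: "{a, b, c, e} \<subseteq> E"
  shows "balanced {f (zs @ [a, b]) * f (zs @ [c, e]), - (f (zs @ [a, c]) * f (zs @ [b, e])),
    f (zs @ [a, e]) * f (zs @ [b, c])}"
proof -
  define n where "n = length zs"
  define ys where "ys = zs @ [b, c, e]"
  let ?t = "exchange_term f (zs @ [a]) ys"
  have "ys \<in> tuples E (d + 1)" "length (zs @ [a]) + 1 = d" "set (zs @ [a]) \<subseteq> E"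
    using zs E by (auto simp: ys_def tuples_def)
  then have bal: "balanced (?t ` {1..d + 1})"
    using ch unfolding chirotope_def balanced_def by blast
  have zero: "?t k = 0" if "k \<in> {1..n}" for k
  proof -
    have k: "ys ! (k - 1) \<in> set zs" using that by (auto simp: ys_def nth_append n_def)
    then have "\<not> distinct ((zs @ [a]) @ [ys ! (k - 1)])" "(zs @ [a]) @ [ys ! (k - 1)] \<in> tuples E d"
      using zs E by (auto simp: tuples_def)
    then have "f ((zs @ [a]) @ [ys ! (k - 1)]) = 0"
      using ch unfolding chirotope_def alternating_sign_map_def by blast
    then show ?thesis by (simp add: exchange_term_def)
  qed
  have "{1..d + 1} = {1..n} \<union> {n + 1, n + 2, n + 3}" using zs by (auto simp: n_def)
  then have "?t ` {1..d + 1} = ?t ` {1..n} \<union> {?t (n + 1), ?t (n + 2), ?t (n + 3)}"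
    by (simp add: image_Un)
  then have "?t ` {1..d + 1} - {0} = {?t (n + 1), ?t (n + 2), ?t (n + 3)} - {0}"
    using zero by auto
  then have "balanced {?t (n + 1), ?t (n + 2), ?t (n + 3)}"
    using bal balanced_minus_zero by metis
  from balanced_scale[OF this, of "(-1) ^ (n + 1)"] show ?thesis
    by (simp add: exchange_term_def ys_def n_def nth_append power_add mult.assoc
        flip: power_mult_distrib)
qed

section \<open>Matroid polytopes\<close>

lemma basis_vec_nth: "basis_vec B $ i = of_bool (i \<in> B)"
  by (simp add: basis_vec_def axis_def of_bool_def)

lemma inj_basis_vec: "inj basis_vec"
proof (rule injI)
  fix A B :: "'a set" assume "basis_vec A = basis_vec B"
  then have "\<And>i. (of_bool (i \<in> A) :: real) = of_bool (i \<in> B)" by (metis basis_vec_nth)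
  then show "A = B" by (metis of_bool_eq_iff subsetI subset_antisym)
qed

text \<open>The coordinates of the vertices are 0 or 1, so where a convex combination attains one of
  these extreme values, every basis of positive weight attains it too.\<close>

lemma matroid_polytope_coeffs:
  fixes \<N> :: "'e::finite set set"
  assumes "q \<in> matroid_polytope \<N>"
  obtains w :: "'e set \<Rightarrow> real" where "\<And>B. B \<in> \<N> \<Longrightarrow> w B \<ge> 0" "sum w \<N> = 1"
    "\<And>i. q $ i = (\<Sum>B\<in>\<N>. w B * of_bool (i \<in> B))"
    "\<And>B i. B \<in> \<N> \<Longrightarrow> w B > 0 \<Longrightarrow> q $ i = 1 \<Longrightarrow> i \<in> B"
    "\<And>B i. B \<in> \<N> \<Longrightarrow> w B > 0 \<Longrightarrow> q $ i = 0 \<Longrightarrow> i \<notin> B"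
proof -
  have inj: "inj_on basis_vec \<N>" using inj_basis_vec inj_on_subset by blast
  obtain u where u: "\<And>x. x \<in> basis_vec ` \<N> \<Longrightarrow> u x \<ge> 0" "sum u (basis_vec ` \<N>) = 1"
    "(\<Sum>x\<in>basis_vec ` \<N>. u x *\<^sub>R x) = q"
    using assms unfolding matroid_polytope_def by (auto simp: convex_hull_finite)
  define w where "w B = u (basis_vec B)" for B
  have nn: "w B \<ge> 0" if "B \<in> \<N>" for B using u(1) that by (simp add: w_def)
  have one: "sum w \<N> = 1" using u(2) inj by (simp add: w_def sum.reindex)
  have co: "q $ i = (\<Sum>B\<in>\<N>. w B * of_bool (i \<in> B))" for i
    using inj by (simp flip: u(3) add: sum.reindex w_def basis_vec_nth)
  show thesis
  proof (rule that[OF nn one co])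
    fix B i assume B: "B \<in> \<N>" "w B > 0" "q $ i = 1"
    have "(\<Sum>B\<in>\<N>. w B * (1 - of_bool (i \<in> B))) = 0"
      using one co[of i] B by (simp add: right_diff_distrib sum_subtractf)
    then have "w B * (1 - of_bool (i \<in> B)) = 0"
      using nn B by (subst (asm) sum_nonneg_eq_0_iff) auto
    then show "i \<in> B" using B by (cases "i \<in> B") auto
  next
    fix B i assume B: "B \<in> \<N>" "w B > 0" "q $ i = 0"
    then have "(\<Sum>B\<in>\<N>. w B * of_bool (i \<in> B)) = 0" using co[of i] by simp
    then have "w B * of_bool (i \<in> B) = 0"
      using nn B by (subst (asm) sum_nonneg_eq_0_iff) auto
    then show "i \<notin> B" using B by auto
  qed
qed

lemma sum_pos_witness:
  fixes w :: "'b \<Rightarrow> real"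
  assumes "sum w A > 0"
  obtains x where "x \<in> A" "w x > 0"
  using assms sum_nonpos[of A w] by (meson not_le)

lemma basis_vec_in_matroid_polytope: "B \<in> \<N> \<Longrightarrow> basis_vec B \<in> matroid_polytope \<N>"
  unfolding matroid_polytope_def by (intro hull_inc) auto

text \<open>All coordinates of \<open>basis_vec B\<close> are 0 or 1, so any basis of positive
  weight in a convex combination giving this point equals \<open>B\<close>.\<close>

lemma matroid_polytope_subsetD:
  assumes "matroid_polytope \<N> \<subseteq> matroid_polytope \<B>"
  shows "\<N> \<subseteq> \<B>"
proof
  fix B assume "B \<in> \<N>"
  then have "basis_vec B \<in> matroid_polytope \<B>" using assms basis_vec_in_matroid_polytope by blast
  then show "B \<in> \<B>"
  proof (rule matroid_polytope_coeffs)
    fix w :: "'a set \<Rightarrow> real"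
    assume one: "sum w \<B> = 1"
      and w: "\<And>A i. A \<in> \<B> \<Longrightarrow> w A > 0 \<Longrightarrow> basis_vec B $ i = 1 \<Longrightarrow> i \<in> A"
        "\<And>A i. A \<in> \<B> \<Longrightarrow> w A > 0 \<Longrightarrow> basis_vec B $ i = 0 \<Longrightarrow> i \<notin> A"
    obtain A where A: "A \<in> \<B>" "w A > 0" using sum_pos_witness[of w \<B>] one by auto
    have "i \<in> A \<longleftrightarrow> i \<in> B" for i using w[OF A, of i] by (auto simp: basis_vec_nth)
    then show "B \<in> \<B>" using A by (metis set_eqI)
  qed
qed

text \<open>Off \<open>F\<close> the coordinates are 0 or 1, so bases of positive weight lie between
  \<open>S\<close> and \<open>S \<union> F\<close>. Let \<open>S \<union> U\<close> be one of them.
  The weighted mean of \<open>card (B \<inter> (F - U))\<close> is twice 1/2, while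
  \<open>S \<union> U\<close> contributes 0; hence some basis of positive weight contains
  \<open>F - U\<close>, and by its size it is \<open>S \<union> (F - U)\<close>.\<close>

lemma complementary_bases:
  fixes \<N> :: "'e::finite set set"
  assumes q: "basis_vec S + (1/2) *\<^sub>R basis_vec F \<in> matroid_polytope \<N>"
    and card: "\<And>B. B \<in> \<N> \<Longrightarrow> card B = card S + 2" and F: "card F = 4" "S \<inter> F = {}"
  obtains U where "U \<subseteq> F" "card U = 2" "S \<union> U \<in> \<N>" "S \<union> (F - U) \<in> \<N>"
proof -
  let ?q = "basis_vec S + (1/2) *\<^sub>R basis_vec F :: real ^ 'e"
  have qi: "?q $ i = (if i \<in> S then 1 else if i \<in> F then 1/2 else 0)" for i
    using F by (auto simp: basis_vec_nth)
  obtain w :: "'e set \<Rightarrow> real" where w: "\<And>B. B \<in> \<N> \<Longrightarrow> w B \<ge> 0" "sum w \<N> = 1"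
    "\<And>i. ?q $ i = (\<Sum>B\<in>\<N>. w B * of_bool (i \<in> B))"
    "\<And>B i. B \<in> \<N> \<Longrightarrow> w B > 0 \<Longrightarrow> ?q $ i = 1 \<Longrightarrow> i \<in> B"
    "\<And>B i. B \<in> \<N> \<Longrightarrow> w B > 0 \<Longrightarrow> ?q $ i = 0 \<Longrightarrow> i \<notin> B"
    by (rule matroid_polytope_coeffs[OF q]) blast
  have between: "S \<subseteq> B" "B \<subseteq> S \<union> F" if "B \<in> \<N>" "w B > 0" for B
  proof -
    show "S \<subseteq> B" using w(4)[OF that] qi by auto
    have "x \<notin> B" if "x \<notin> S \<union> F" for x
      using w(5)[OF \<open>B \<in> \<N>\<close> \<open>w B > 0\<close>, of x] qi[of x] that by simp
    then show "B \<subseteq> S \<union> F" by blast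
  qed
  obtain B0 where B0: "B0 \<in> \<N>" "w B0 > 0" using sum_pos_witness[of w \<N>] w(2) by auto
  define U where "U = B0 \<inter> F"
  have SU: "S \<union> U = B0" using between[OF B0] by (auto simp: U_def)
  have "S \<inter> U = {}" using F by (auto simp: U_def)
  then have cU: "card U = 2" using card[OF B0(1)] SU card_Un_disjoint[of S U] by simp
  define G where "G = F - U"
  have cG: "card G = 2" using F cU by (simp add: G_def U_def card_Diff_subset)
  have "\<exists>B\<in>\<N>. w B > 0 \<and> card (B \<inter> G) \<ge> 2"
  proof (rule ccontr)
    assume no: "\<not> ?thesis"
    have "(\<Sum>B\<in>\<N>. w B * card (B \<inter> G)) = (\<Sum>B\<in>\<N>. \<Sum>i\<in>G. w B * of_bool (i \<in> B))"
      by (simp add: sum_distrib_left[symmetric] Int_commute)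
    also have "\<dots> = (\<Sum>i\<in>G. ?q $ i)" unfolding w(3) by (rule sum.swap)
    also have "\<dots> = (\<Sum>i\<in>G. 1/2)"
      using F unfolding qi by (intro sum.cong) (auto simp: G_def)
    also have "\<dots> = 1" using cG by simp
    finally have "(\<Sum>B\<in>\<N>. w B * (1 - real (card (B \<inter> G)))) = 0"
      using w(2) by (simp add: right_diff_distrib sum_subtractf)
    moreover have "w B * (1 - real (card (B \<inter> G))) \<ge> 0" if "B \<in> \<N>" for B
    proof (cases "w B > 0")
      case True
      then have "card (B \<inter> G) \<le> 1" using no that by force
      then show ?thesis using True by simp
    next
      case False
      then have "w B = 0" using w(1)[OF that] by simp
      then show ?thesis by simp
    qed
    ultimately have "w B0 * (1 - real (card (B0 \<inter> G))) = 0"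
      using B0 by (subst (asm) sum_nonneg_eq_0_iff) auto
    moreover have "B0 \<inter> G = {}" by (auto simp: G_def U_def)
    ultimately show False using B0 by simp
  qed
  then obtain B1 where B1: "B1 \<in> \<N>" "w B1 > 0" "card (B1 \<inter> G) \<ge> 2" by blast
  have "B1 \<inter> G = G" using B1 cG by (intro card_seteq) auto
  then have "S \<union> G \<subseteq> B1" using between[OF B1(1,2)] by auto
  moreover have "card (S \<union> G) = card B1"
    using card[OF B1(1)] cG F by (subst card_Un_disjoint) (auto simp: G_def)
  ultimately have "S \<union> G = B1" by (intro card_subset_eq) auto
  then show thesis using that[of U] SU cU B0 B1 by (simp add: U_def G_def)
qed

section \<open>Three-term relations from a matroid subdivision\<close>

lemma matroid_subdivision_cells:
  assumes "matroid_subdivision E \<B> \<M>"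
  shows "(\<Union>\<N>\<in>\<M>. matroid_polytope \<N>) = matroid_polytope \<B>"
proof
  have un: "\<Union>(\<Union>\<N>\<in>\<M>. {F. F face_of matroid_polytope \<N>}) = matroid_polytope \<B>"
    using assms unfolding matroid_subdivision_def polyhedral_subdivision_def by blast
  show "(\<Union>\<N>\<in>\<M>. matroid_polytope \<N>) \<subseteq> matroid_polytope \<B>"
    unfolding un[symmetric] using face_of_refl[OF convex_convex_hull]
    unfolding matroid_polytope_def by blast
  show "matroid_polytope \<B> \<subseteq> (\<Union>\<N>\<in>\<M>. matroid_polytope \<N>)"
    unfolding un[symmetric] using face_of_imp_subset by blast
qed

lemma three_term_of_covering:
  fixes E :: "'e::finite set"
  assumes SB: "signed_bases E \<B> d f"
    and cover: "(\<Union>\<N>\<in>\<M>. matroid_polytope \<N>) = matroid_polytope \<B>"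
    and ch: "\<And>\<N>. \<N> \<in> \<M> \<Longrightarrow> chirotope E d (restrict_to_bases f \<N>)"
    and zs: "length zs + 2 = d" "set zs \<subseteq> E" and E: "{a, b, c, e} \<subseteq> E"
  shows "balanced {f (zs @ [a, b]) * f (zs @ [c, e]), - (f (zs @ [a, c]) * f (zs @ [b, e])),
    f (zs @ [a, e]) * f (zs @ [b, c])}"
proof -
  interpret signed_bases E \<B> d f by fact
  have tup: "zs @ [p, q] \<in> tuples E d" if "p \<in> {a, b, c, e}" "q \<in> {a, b, c, e}" for p q
    using that zs E by (auto simp: tuples_def)
  have sw: "f (zs @ [p, q]) = - f (zs @ [q, p])" if "p \<in> {a, b, c, e}" "q \<in> {a, b, c, e}" for p q
    using f_swap[of zs q p "[]"] tup that by simp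
  have nd: "f (zs @ [p, q]) = 0" if "p \<in> {a, b, c, e}" "q \<in> {a, b, c, e}" "\<not> distinct (zs @ [p, q])" for p q
    using f_nondistinct tup that by blast
  define T where "T g = {g (zs @ [a, b]) * g (zs @ [c, e]), - (g (zs @ [a, c]) * g (zs @ [b, e])),
    g (zs @ [a, e]) * g (zs @ [b, c])}" for g :: "'e list \<Rightarrow> int"
  have "balanced (T f)"
  proof (cases "distinct (zs @ [a, b, c, e])")
    case False
    \<comment> \<open>If two of \<open>a, b, c, e\<close> coincide, one term vanishes and the other
      two are opposite.\<close>
    have cancel: ?thesis if "T f = {0, - u, u}" for u
      unfolding that by (auto simp: balanced_def)
    consider "\<not> distinct zs \<or> set zs \<inter> {a, b, c, e} \<noteq> {}" | "a = b" | "a = c" | "a = e"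
      | "b = c" | "b = e" | "c = e"
      using False by auto
    then show ?thesis
    proof cases
      case 1
      then show ?thesis using nd by (auto simp: T_def balanced_def)
    next
      case 2
      show ?thesis
        by (rule cancel[of "f (zs @ [b, e]) * f (zs @ [b, c])"])
          (use 2 nd[of a a] in \<open>simp add: T_def mult.commute insert_commute\<close>)
    next
      case 3
      show ?thesis
        by (rule cancel[of "f (zs @ [a, b]) * f (zs @ [a, e])"])
          (use 3 nd[of a a] sw[of b a] in \<open>simp add: T_def mult.commute insert_commute\<close>)
    next
      case 4
      show ?thesis
        by (rule cancel[of "f (zs @ [a, b]) * f (zs @ [a, c])"])
          (use 4 nd[of a a] sw[of b a] sw[of c a] in \<open>simp add: T_def mult.commute insert_commute\<close>)
    next
      case 5
      show ?thesis
        by (rule cancel[of "f (zs @ [a, b]) * f (zs @ [b, e])"])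
          (use 5 nd[of b b] in \<open>simp add: T_def mult.commute insert_commute\<close>)
    next
      case 6
      show ?thesis
        by (rule cancel[of "f (zs @ [a, b]) * f (zs @ [b, c])"])
          (use 6 nd[of b b] sw[of c b] in \<open>simp add: T_def mult.commute insert_commute\<close>)
    next
      case 7
      show ?thesis
        by (rule cancel[of "f (zs @ [a, c]) * f (zs @ [b, c])"])
          (use 7 nd[of c c] in \<open>simp add: T_def mult.commute insert_commute\<close>)
    qed
  next
    case True
    define S F where "S = set zs" and "F = {a, b, c, e}"
    have SF: "card F = 4" "S \<inter> F = {}" "card S + 2 = d"
      using True zs by (auto simp: S_def F_def distinct_card)
    let ?q = "basis_vec S + (1/2) *\<^sub>R basis_vec F :: real ^ 'e"
    show ?thesis
    proof (cases "\<forall>u\<in>T f. u = 0")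
      case False
      have "\<exists>U\<subseteq>F. S \<union> U \<in> \<B> \<and> S \<union> (F - U) \<in> \<B>"
      proof -
        from False consider "S \<union> {a, b} \<in> \<B>" "S \<union> {c, e} \<in> \<B>" | "S \<union> {a, c} \<in> \<B>" "S \<union> {b, e} \<in> \<B>"
          | "S \<union> {a, e} \<in> \<B>" "S \<union> {b, c} \<in> \<B>"
          using supp[OF tup] by (auto simp: T_def S_def)
        moreover have "F - {a, b} = {c, e}" "F - {a, c} = {b, e}" "F - {a, e} = {b, c}"
          using True by (auto simp: F_def)
        moreover have "{a, b} \<subseteq> F" "{a, c} \<subseteq> F" "{a, e} \<subseteq> F" by (auto simp: F_def)
        ultimately show ?thesis by metis
      qed
      then obtain U where U: "U \<subseteq> F" "S \<union> U \<in> \<B>" "S \<union> (F - U) \<in> \<B>" by blast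
      \<comment> \<open>The two bases share \<open>S\<close> and split \<open>F\<close> between
        them.\<close>
      have "?q = (1/2) *\<^sub>R basis_vec (S \<union> U) + (1/2) *\<^sub>R basis_vec (S \<union> (F - U))"
        using U SF by (auto simp: vec_eq_iff basis_vec_nth of_bool_def)
      also have "\<dots> \<in> matroid_polytope \<B>"
        using basis_vec_in_matroid_polytope[OF U(2)] basis_vec_in_matroid_polytope[OF U(3)]
        unfolding matroid_polytope_def by (intro convexD[OF convex_convex_hull]) auto
      finally obtain \<N> where N: "\<N> \<in> \<M>" "?q \<in> matroid_polytope \<N>" using cover by blast
      \<comment> \<open>This inclusion fixes the size of the members of \<open>\<N>\<close> and
        makes \<open>f\<close> non-zero on them.\<close>
      have NB: "\<N> \<subseteq> \<B>" using cover N(1) by (intro matroid_polytope_subsetD) blast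
      obtain V where V: "V \<subseteq> F" "card V = 2" "S \<union> V \<in> \<N>" "S \<union> (F - V) \<in> \<N>"
      proof (rule complementary_bases[OF N(2)])
        show "card B = card S + 2" if "B \<in> \<N>" for B using card_basis NB that SF by auto
      qed (use SF in auto)
      define g where "g = restrict_to_bases f \<N>"
      have bal: "balanced (T g)"
        unfolding T_def g_def by (rule chirotope_three_term[OF ch[OF N(1)] zs E])
      have g_nz: "g (zs @ [p, q]) \<noteq> 0 \<longleftrightarrow> S \<union> {p, q} \<in> \<N>"
        if "p \<in> {a, b, c, e}" "q \<in> {a, b, c, e}" for p q
        using supp[OF tup[OF that]] NB by (auto simp: g_def restrict_to_bases_def S_def)
      have "\<exists>u\<in>T g. u \<noteq> 0"
      proof -
        obtain p q where pq: "V = {p, q}" "p \<noteq> q" using V(2) by (auto simp: card_2_iff)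
        have "p \<in> {a, b, c, e}" "q \<in> {a, b, c, e}" using pq V(1) by (auto simp: F_def)
        then have "V = {a, b} \<or> V = {c, e} \<or> V = {a, c} \<or> V = {b, e} \<or> V = {a, e} \<or> V = {b, c}"
          using pq by (elim insertE emptyE; simp add: insert_commute)
        moreover have "F - {a, b} = {c, e}" "F - {c, e} = {a, b}" "F - {a, c} = {b, e}"
          "F - {b, e} = {a, c}" "F - {a, e} = {b, c}" "F - {b, c} = {a, e}"
          using True by (auto simp: F_def)
        ultimately have "S \<union> {a, b} \<in> \<N> \<and> S \<union> {c, e} \<in> \<N> \<or> S \<union> {a, c} \<in> \<N> \<and> S \<union> {b, e} \<in> \<N>
            \<or> S \<union> {a, e} \<in> \<N> \<and> S \<union> {b, c} \<in> \<N>"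
          using V(3,4) by (elim disjE) simp_all
        then show ?thesis
          using g_nz[of a b] g_nz[of c e] g_nz[of a c] g_nz[of b e] g_nz[of a e] g_nz[of b c]
          by (auto simp: T_def)
      qed
      \<comment> \<open>A non-zero product has both factors unaffected by the restriction, so both
        signs carry over from \<open>g\<close> to \<open>f\<close>.\<close>
      moreover have "u \<in> T f" if "u \<in> T g" "u \<noteq> 0" for u
        using that by (auto simp: T_def g_def restrict_to_bases_def split: if_splits)
      ultimately show ?thesis using bal unfolding balanced_def by (metis less_irrefl)
    qed (simp add: balanced_def)
  qed
  then show ?thesis by (simp add: T_def)
qed

theorem theorem3p9:
  fixes E :: "'e::{finite,linorder} set"
    and \<B> :: "'e set set"
    and d k :: nat
    and Ms :: "nat \<Rightarrow> 'e set set"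
    and X :: "'e list \<Rightarrow> int"
  assumes "matroid E \<B>"
    and "matroid_rank \<B> = d"
    and "matroid_subdivision E \<B> (Ms ` {1..k})"
    and "alternating_sign_map E d X"
    and "supported_on E d X \<B>"
    and "\<And>i. i \<in> {1..k} \<Longrightarrow> chirotope E d (restrict_to_bases X (Ms i))"
  shows "chirotope E d X"
proof -
  have card: "card B = d" if "B \<in> \<B>" for B
  proof -
    have "card ` \<B> = {card B}" using matroid_bases_card_eq[OF assms(1) _ that] that by blast
    then show ?thesis using assms(2) by (simp add: matroid_rank_def)
  qed
  have SB: "signed_bases E \<B> d X"
    using assms(1,4) card alternating_nonzero_iff[OF assms(4,5)] by unfold_locales auto
  interpret three_term_bases E \<B> d X
  proof (intro three_term_bases.intro three_term_bases_axioms.intro SB)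
    fix zs :: "'e list" and a b c e
    assume "length zs + 2 = d" "set zs \<subseteq> E" "{a, b, c, e} \<subseteq> E"
    then show "balanced {X (zs @ [a, b]) * X (zs @ [c, e]), - (X (zs @ [a, c]) * X (zs @ [b, e])),
        X (zs @ [a, e]) * X (zs @ [b, c])}"
      by (intro three_term_of_covering[OF SB matroid_subdivision_cells[OF assms(3)]])
        (use assms(6) in blast)+
  qed
  have "\<exists>B\<in>\<B>. B \<subseteq> E" using assms(1) unfolding matroid_def by auto
  then obtain B where B: "B \<in> \<B>" "B \<subseteq> E" by blast
  have nz: "\<exists>xs\<in>tuples E d. X xs \<noteq> 0"
    using B card assms(5) unfolding supported_on_def
    by (intro bexI[of _ "sorted_list_of_set B"]) (auto simp: tuples_def)
  have bal: "balanced (exchange_term X xs ys ` {1..d + 1})"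
    if "length xs + 1 = d \<and> set xs \<subseteq> E \<and> ys \<in> tuples E (d + 1)" for xs ys
  proof -
    \<comment> \<open>Passing from positions counted from 1 to positions counted from 0 multiplies
      every term by -1.\<close>
    have "{1..d + 1} = Suc ` {..d}" by (simp add: image_Suc_atMost)
    then have eq: "exchange_term X xs ys ` {1..d + 1} =
        (*) (-1) ` (\<lambda>k. X (xs @ [ys ! k]) * ((-1) ^ k * X (omit ys k))) ` {..d}"
      by (simp add: image_image exchange_term_def mult_ac)
    show ?thesis unfolding eq using that by (intro balanced_scale exchange_balanced) auto
  qed
  show ?thesis
    unfolding chirotope_def
  proof (intro conjI allI impI assms(4) nz)
    fix xs ys assume "length xs + 1 = d \<and> set xs \<subseteq> E \<and> ys \<in> tuples E (d + 1)"
    from bal[OF this] show "(\<exists>k\<in>{1..d + 1}. exchange_term X xs ys k > 0) \<and>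
        (\<exists>k\<in>{1..d + 1}. exchange_term X xs ys k < 0) \<or>
        (\<forall>k\<in>{1..d + 1}. exchange_term X xs ys k = 0)"
      unfolding balanced_def bex_simps ball_simps .
  qed
qed

end
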